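(* Let $n\in\mathbb N_0$ and $\lambda,\gamma\in\mathbb C$. Then $$\int_{-1}^1(1-x)^{\frac{\lambda}{2}-\gamma}(1+x)^{\frac{\lambda}{2}}\,{\sf P}_{n+\lambda}^{-\lambda}(x)\,\mathrm dx=\frac{2^{\lambda-\gamma+1}\,\Gamma(\lambda-\gamma+1)\,\Gamma(\gamma+n)}{\Gamma(\gamma)\,\Gamma(2\lambda-\gamma+n+2)}.$$
   Context: $\mathbb N_0=\{0,1,2,\ldots\}$ and $\Gamma$ is the gamma function. The Ferrers function of the first kind is, for $x\in(-1,1)$, $${\sf P}_\nu^{-\mu}(x)=\frac{1}{\Gamma(\mu+1)}\left(\frac{1-x}{1+x}\right)^{\frac{\mu}{2}}{}_2F_1\left(-\nu,\nu+1;\mu+1;\frac{1-x}{2}\right),$$ where ${}_2F_1(a,b;c;z)=\sum_{j\ge0}\frac{(a)_j(b)_j}{(c)_j}\frac{z^j}{j!}$ with $(a)_0=1$, $(a)_j=a(a+1)\cdots(a+j-1)$. Powers of positive reals are principal.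
   Formalization: The conditions Re λ > -1 and Re(λ-γ) > -1 are added, without which the integral diverges or P is not properly defined; where γ+n is a nonpositive integer, so Γ(γ+n)/Γ(γ) is undefined, the right side is read as its limit in γ. *)

theory Defs
  imports "HOL-Analysis.Analysis"
begin

definition hypergeom_2F1 :: "complex \<Rightarrow> complex \<Rightarrow> complex \<Rightarrow> complex \<Rightarrow> complex" where
  "hypergeom_2F1 a b c z =
     (\<Sum>j. pochhammer a j * pochhammer b j / pochhammer c j * (z ^ j / fact j))"

(* ferrers_P_neg nu mu x is the Ferrers function of degree nu and order -mu (note the sign).
   It is meaningful for -1 < x < 1 and mu not a negative integer; at mu = -1, -2, ... the
   conventions Gamma z = 0 at poles and w / 0 = 0 make it a junk value rather than the
   regularised limit. *)
definition ferrers_P_neg :: "complex \<Rightarrow> complex \<Rightarrow> real \<Rightarrow> complex" where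
  "ferrers_P_neg \<nu> \<mu> x =
     1 / Gamma (\<mu> + 1) * complex_of_real ((1 - x) / (1 + x)) powr (\<mu> / 2) *
     hypergeom_2F1 (- \<nu>) (\<nu> + 1) (\<mu> + 1) (complex_of_real ((1 - x) / 2))"

end

theory Submission
  imports Defs
begin

text \<open>
  By Euler's transformation, the hypergeometric factor of the Ferrers function of degree \<open>n + \<lambda>\<close>
  and order \<open>- \<lambda>\<close> is \<open>((1 + x) / 2)\<^sup>\<lambda>\<close> times
  \<open>\<^sub>2F\<^sub>1(- n, 2 \<lambda> + n + 1; \<lambda> + 1; (1 - x) / 2)\<close>, a polynomial of degree at most \<open>n\<close>
  (lemmas \<open>hypergeom_2F1_Euler_terminating\<close> and \<open>ferrers_integrand_eq\<close>). The substitution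
  \<open>x = 1 - 2 t\<close> then turns the integrand into a finite linear combination of the functions
  \<open>t\<^bsup>\<lambda> - \<gamma> + k\<^esup> (1 - t)\<^sup>\<lambda>\<close> on \<open>0 < t < 1\<close>, each of which is absolutely integrable with a Beta value as its
  integral (\<open>has_bochner_integral_Beta_complex\<close>). What remains is the balanced terminating sum
  \<open>\<^sub>3F\<^sub>2(- n, 2 \<lambda> + n + 1, \<lambda> - \<gamma> + 1; 2 \<lambda> - \<gamma> + 2, \<lambda> + 1; 1)\<close>, which Saalschuetz's theorem
  (\<open>Saalschuetz\<close>) evaluates.

  Euler's transformation and Saalschuetz's theorem have a common source, the identity of formal
  power series \<open>fps_hypergeo_Euler\<close>. It holds because multiplication by \<open>(1 - X)\<^bsup>c - a - b\<^esup>\<close> carries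
  solutions of the hypergeometric equation with parameters \<open>c - a, c - b, c\<close> to solutions with
  parameters \<open>a, b, c\<close>, and a power series solution is determined by its constant term when \<open>c\<close> is
  not one of \<open>0, -1, -2, \<dots>\<close>.

  The result of the integration contains the rising factorial of \<open>\<gamma>\<close> rather than
  \<open>\<Gamma>(\<gamma> + n) / \<Gamma>(\<gamma>)\<close>. The two agree unless \<open>\<gamma> + n\<close> is a pole of \<open>\<Gamma>\<close>; as the poles are isolated and
  the expression with the rising factorial is continuous in \<open>\<gamma>\<close>, the quotient of Gamma values has it as
  its limit at the exceptional points.
\<close>

section \<open>The Beta integral with complex parameters\<close>

lemma Re_pos_imp_not_nonpos_Int: "Re z > 0 \<Longrightarrow> z \<notin> \<int>\<^sub>\<le>\<^sub>0"
  by (auto elim!: nonpos_Ints_cases')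

text \<open>
  The principal power \<open>r\<^sup>s\<close> of a real base with a complex exponent, set to \<open>0\<close> for \<open>r \<le> 0\<close>.
  The cut-off absorbs the indicator functions of the ranges of integration: the Gamma integrand
  lives on \<open>t > 0\<close> and the Beta integrand on \<open>0 < t < 1\<close> without further mention.
\<close>
definition real_cpow :: "real \<Rightarrow> complex \<Rightarrow> complex" where
  "real_cpow r s = (if 0 < r then complex_of_real r powr s else 0)"

lemma real_cpow_altdef:
  "real_cpow r s = indicator {0<..} r *\<^sub>R exp (s * complex_of_real (ln r))"
  by (auto simp: real_cpow_def powr_def Ln_of_real mult.commute)

lemma borel_measurable_real_cpow [measurable (raw)]:
  assumes [measurable]: "f \<in> borel_measurable M"
  shows "(\<lambda>x. real_cpow (f x) s) \<in> borel_measurable M"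
  unfolding real_cpow_altdef by measurable

lemma norm_real_cpow: "norm (real_cpow r s) = (if 0 < r then r powr Re s else 0)"
  by (simp add: real_cpow_def norm_powr_real_powr)

lemma real_cpow_mult_left:
  assumes "0 < c"
  shows "real_cpow (c * r) s = real_cpow c s * real_cpow r s"
  using assms
  by (auto simp: real_cpow_altdef indicator_def zero_less_mult_iff ln_mult algebra_simps exp_add)

lemma real_cpow_add: "real_cpow r (s + s') = real_cpow r s * real_cpow r s'"
  by (auto simp: real_cpow_altdef indicator_def algebra_simps exp_add)

lemma real_cpow_1: "0 < r \<Longrightarrow> real_cpow r 1 = of_real r"
  by (simp add: real_cpow_def)

lemma has_bochner_integral_Gamma:
  assumes "Re z > 0"
  shows "has_bochner_integral lborel (\<lambda>t. real_cpow t (z - 1) * of_real (exp (- t))) (Gamma z)"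
proof -
  let ?f = "\<lambda>t. complex_of_real t powr (z - 1) / of_real (exp t)"
  let ?g = "\<lambda>t. real_cpow t (z - 1) * of_real (exp (- t))"
  have eq: "(\<lambda>t. indicator {0<..} t *\<^sub>R ?f t) = ?g"
    by (auto simp: fun_eq_iff real_cpow_def indicator_def exp_minus divide_simps)
  have "set_integrable lebesgue {0<..} ?f"
    by (rule absolutely_integrable_Gamma_integral'[OF assms])
  hence "integrable lebesgue ?g"
    by (simp add: set_integrable_def eq)
  hence int: "integrable lborel ?g"
    by (subst (asm) integrable_completion) auto
  hence "set_integrable lborel {0<..} ?f"
    by (simp add: set_integrable_def eq)
  hence "(\<integral>t. ?g t \<partial>lborel) = integral {0<..} ?f"
    using set_borel_integral_eq_integral(2)[of "{0<..}" ?f]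
    by (simp add: set_lebesgue_integral_def eq)
  also have "\<dots> = Gamma z"
    using Gamma_integral_complex'[OF assms] by (rule integral_unique)
  finally show ?thesis using int by (simp add: has_bochner_integral_iff)
qed

text \<open>
  The classical evaluation: integrate
  \<open>t\<^bsup>a - 1\<^esup> (u - t)\<^bsup>b - 1\<^esup> e\<^bsup>- u\<^esup>\<close> over \<open>0 < t < u\<close> in both orders. The inner integral
  over \<open>t\<close> is the Beta integral times \<open>u\<^bsup>a + b - 1\<^esup> e\<^bsup>- u\<^esup>\<close>, so one order gives
  \<open>\<Gamma>(a + b)\<close> times the Beta integral; the other order gives \<open>\<Gamma>(a) \<Gamma>(b)\<close>. The same scaling applied to
  norms supplies the integrability that Fubini's theorem needs.
\<close>
theorem has_bochner_integral_Beta_complex: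
  assumes a: "Re a > 0" and b: "Re b > 0"
  shows "has_bochner_integral lborel (\<lambda>t. real_cpow t (a - 1) * real_cpow (1 - t) (b - 1)) (Beta a b)"
proof -
  define k where "k t = real_cpow t (a - 1) * real_cpow (1 - t) (b - 1)" for t
  define w where "w u = real_cpow u (a + b - 1) * of_real (exp (- u))" for u
  define K where "K u t = real_cpow t (a - 1) * real_cpow (u - t) (b - 1) * of_real (exp (- u))" for u t
  have [measurable]: "k \<in> borel_measurable borel" unfolding k_def by measurable
  have [measurable]: "case_prod K \<in> borel_measurable (lborel \<Otimes>\<^sub>M lborel)"
    unfolding K_def case_prod_unfold by measurable
  have k_int: "integrable lborel k"
  proof (rule Bochner_Integration.integrable_bound[OF _ _ AE_I2])
    show "integrable lborel (\<lambda>t. indicator {0..1} t *\<^sub>R (t powr (Re a - 1) * (1 - t) powr (Re b - 1)))"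
      using integrable_Beta[OF a b] by (simp add: set_integrable_def)
    show "norm (k t) \<le> norm (indicator {0..1} t *\<^sub>R (t powr (Re a - 1) * (1 - t) powr (Re b - 1)))" for t :: real
      by (auto simp: k_def norm_mult norm_real_cpow indicator_def)
  qed simp
  \<comment> \<open>Substituting \<open>t \<rightarrow> u t\<close> separates the variables.\<close>
  have scale: "u *\<^sub>R K u (0 + u * t) = w u * k t" if "0 < u" for u t
  proof -
    have "u *\<^sub>R K u (0 + u * t) = real_cpow u 1 * real_cpow (u * t) (a - 1) * real_cpow (u * (1 - t)) (b - 1) * of_real (exp (- u))"
      using that by (simp add: K_def real_cpow_1 scaleR_conv_of_real algebra_simps)
    also have "\<dots> = real_cpow u (1 + (a - 1) + (b - 1)) * of_real (exp (- u)) * k t"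
      unfolding real_cpow_mult_left[OF that] real_cpow_add k_def by (simp only: mult_ac)
    also have "1 + (a - 1) + (b - 1) = a + b - 1" by simp
    finally show ?thesis by (simp add: w_def)
  qed
  have K_0: "K u t = 0" if "u \<le> 0" for u t
    using that by (auto simp: K_def real_cpow_def)
  have inner: "has_bochner_integral lborel (K u) (w u * integral\<^sup>L lborel k)" for u
  proof (cases "u > 0")
    case True
    have "has_bochner_integral lborel (\<lambda>t. (w u * k t) /\<^sub>R u) ((w u * integral\<^sup>L lborel k) /\<^sub>R u)"
      using has_bochner_integral_integrable[OF k_int]
      by (intro has_bochner_integral_scaleR_right has_bochner_integral_mult_right) auto
    also have "(\<lambda>t. (w u * k t) /\<^sub>R u) = (\<lambda>t. K u (0 + u * t))"
      using True by (simp add: scale [symmetric])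
    finally show ?thesis
      using True lborel_has_bochner_integral_real_affine_iff[of u "K u" "w u * integral\<^sup>L lborel k" 0]
      by simp
  next
    case False
    hence "K u = (\<lambda>_. 0)" by (simp add: K_0 fun_eq_iff)
    with False show ?thesis by (simp add: w_def real_cpow_def has_bochner_integral_zero)
  qed
  have inner_norm: "(\<integral>t. norm (K u t) \<partial>lborel) = norm (w u) * (\<integral>t. norm (k t) \<partial>lborel)" for u
  proof (cases "u > 0")
    case True
    have "(\<integral>t. norm (K u t) \<partial>lborel) = \<bar>u\<bar> *\<^sub>R (\<integral>t. norm (K u (0 + u * t)) \<partial>lborel)"
      using True by (intro lborel_integral_real_affine) auto
    also have "\<dots> = (\<integral>t. norm (u *\<^sub>R K u (0 + u * t)) \<partial>lborel)" by simp
    also have "\<dots> = (\<integral>t. norm (w u) * norm (k t) \<partial>lborel)"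
      using True by (simp only: scale norm_mult)
    finally show ?thesis by simp
  qed (simp add: K_0 w_def real_cpow_def)
  have w: "has_bochner_integral lborel w (Gamma (a + b))"
    unfolding w_def using a b by (intro has_bochner_integral_Gamma) auto
  have "integrable (lborel \<Otimes>\<^sub>M lborel) (case_prod K)"
  proof (rule lborel_pair.Fubini_integrable)
    show "integrable lborel (\<lambda>u. \<integral>t. norm (case_prod K (u, t)) \<partial>lborel)"
      using w by (simp add: inner_norm has_bochner_integral_iff)
    show "AE u in lborel. integrable lborel (\<lambda>t. case_prod K (u, t))"
      using inner by (simp add: has_bochner_integral_iff)
  qed simp
  from lborel_pair.Fubini_integral[OF this]
  have "(\<integral>u. \<integral>t. K u t \<partial>lborel \<partial>lborel) = (\<integral>t. \<integral>u. K u t \<partial>lborel \<partial>lborel)" by simp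
  moreover have "(\<integral>t. K u t \<partial>lborel) = w u * integral\<^sup>L lborel k" for u
    using inner by (rule has_bochner_integral_integral_eq)
  moreover have "(\<integral>u. K u t \<partial>lborel) = real_cpow t (a - 1) * of_real (exp (- t)) * Gamma b" for t
  proof -
    have "(\<integral>u. K u t \<partial>lborel) = (\<integral>v. K (t + v) t \<partial>lborel)"
      using lborel_integral_real_affine[of 1 "\<lambda>u. K u t" t] by simp
    also have "(\<lambda>v. K (t + v) t) = (\<lambda>v. real_cpow t (a - 1) * of_real (exp (- t)) *
                   (real_cpow v (b - 1) * of_real (exp (- v))))"
      by (simp add: K_def exp_add exp_diff exp_minus fun_eq_iff divide_simps)
    also have "integral\<^sup>L lborel \<dots> = real_cpow t (a - 1) * of_real (exp (- t)) * Gamma b"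
      using has_bochner_integral_mult_right[OF has_bochner_integral_Gamma[OF b]]
      by (rule has_bochner_integral_integral_eq)
    finally show ?thesis .
  qed
  ultimately have "Gamma (a + b) * integral\<^sup>L lborel k = Gamma a * Gamma b"
    using w has_bochner_integral_Gamma[OF a] by (simp add: has_bochner_integral_iff)
  moreover have "Gamma (a + b) \<noteq> 0"
    using a b by (simp add: Gamma_eq_zero_iff Re_pos_imp_not_nonpos_Int)
  ultimately have "integral\<^sup>L lborel k = Beta a b"
    by (simp add: Beta_def field_simps)
  hence "has_bochner_integral lborel k (Beta a b)"
    using k_int by (simp add: has_bochner_integral_iff)
  thus ?thesis by (simp only: k_def [abs_def])
qed

section \<open>The formal hypergeometric equation and Euler's transformation\<close>

unbundle no vec_syntax and fps_syntax

text \<open>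
  The left-hand side of the hypergeometric equation
  \<open>X (1 - X) F'' + (c - (a + b + 1) X) F' - a b F = 0\<close> for formal power series.
\<close>
definition fps_hypergeo_op :: "'a::field_char_0 \<Rightarrow> 'a \<Rightarrow> 'a \<Rightarrow> 'a fps \<Rightarrow> 'a fps" where
  "fps_hypergeo_op a b c F =
     fps_X * (1 - fps_X) * fps_deriv (fps_deriv F) +
     (fps_const c - fps_const (a + b + 1) * fps_X) * fps_deriv F - fps_const (a * b) * F"

text \<open>
  In terms of coefficients the equation is the two-term recurrence of the hypergeometric series.
  Hence a solution is determined by its constant term as long as no factor \<open>c + n\<close> vanishes.
\<close>
lemma fps_hypergeo_op_nth:
  "fps_hypergeo_op a b c F $ n =
     of_nat (Suc n) * (c + of_nat n) * F $ Suc n - (a + of_nat n) * (b + of_nat n) * F $ n"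
proof -
  have eq: "fps_hypergeo_op a b c F =
     fps_X * fps_deriv (fps_deriv F) - fps_X * (fps_X * fps_deriv (fps_deriv F)) +
     fps_const c * fps_deriv F - fps_const (a + b + 1) * (fps_X * fps_deriv F) - fps_const (a * b) * F"
    by (simp add: fps_hypergeo_op_def algebra_simps)
  show ?thesis
  proof (cases n)
    case (Suc m)
    thus ?thesis unfolding eq by (cases m) (simp_all add: algebra_simps)
  qed (simp add: eq algebra_simps)
qed

lemma fps_hypergeo_2_1_nth:
  "fps_hypergeo [a, b] [c] 1 $ n = pochhammer a n * pochhammer b n / (pochhammer c n * fact n)"
  by simp

lemma fps_hypergeo_1_0_nth: "fps_hypergeo [a] [] 1 $ n = pochhammer a n / fact n"
  by simp

lemma not_nonpos_Int_imp_add_of_nat_neq_0: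
  assumes "(c :: 'a :: field_char_0) \<notin> \<int>\<^sub>\<le>\<^sub>0"
  shows "c + of_nat n \<noteq> 0"
  using assms by (auto simp: add_eq_0_iff2)

lemma fps_hypergeo_op_eq_0:
  assumes "c \<notin> \<int>\<^sub>\<le>\<^sub>0"
  shows "fps_hypergeo_op a b c (fps_hypergeo [a, b] [c] 1) = 0"
proof (rule fps_ext)
  fix n
  have "of_nat (Suc n) \<noteq> (0 :: 'a)" by (simp only: of_nat_eq_0_iff)
  thus "fps_hypergeo_op a b c (fps_hypergeo [a, b] [c] 1) $ n = 0 $ n"
    using not_nonpos_Int_imp_add_of_nat_neq_0[OF assms, of n]
    unfolding fps_hypergeo_op_nth fps_hypergeo_2_1_nth
    by (simp add: pochhammer_Suc divide_simps del: of_nat_Suc)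
qed

lemma fps_hypergeo_op_unique:
  assumes c: "c \<notin> \<int>\<^sub>\<le>\<^sub>0"
    and F: "fps_hypergeo_op a b c F = 0" and G: "fps_hypergeo_op a b c G = 0"
    and 0: "F $ 0 = G $ 0"
  shows "F = G"
proof (rule fps_ext)
  show "F $ n = G $ n" for n
  proof (induction n)
    case (Suc n)
    have nz: "of_nat (Suc n) * (c + of_nat n) \<noteq> 0"
      using not_nonpos_Int_imp_add_of_nat_neq_0[OF c, of n] by (simp del: of_nat_Suc)
    have "of_nat (Suc n) * (c + of_nat n) * F $ Suc n = of_nat (Suc n) * (c + of_nat n) * G $ Suc n"
      using fps_hypergeo_op_nth[of a b c F n] fps_hypergeo_op_nth[of a b c G n] F G Suc.IH
      by simp
    thus ?case using nz by (metis mult_left_cancel)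
  qed (fact 0)
qed

text \<open>
  The series \<open>fps_hypergeo [- s] [] 1\<close> is the binomial series of \<open>(1 - X)\<^sup>s\<close>, and this is the
  first-order equation that characterises it up to a constant factor.
\<close>
lemma fps_deriv_hypergeo_1_0:
  "(1 - fps_X) * fps_deriv (fps_hypergeo [-s] [] 1) = - fps_const s * fps_hypergeo [-s] [] (1::'a::field_char_0)"
  (is "_ * fps_deriv ?P = _")
proof (rule fps_ext)
  fix n
  have eq: "(1 - fps_X) * fps_deriv ?P = fps_deriv ?P - fps_X * fps_deriv ?P"
    by (simp add: algebra_simps)
  have "of_nat (Suc n) \<noteq> (0 :: 'a)" by (simp only: of_nat_eq_0_iff)
  hence 1: "of_nat (Suc n) * ?P $ Suc n = (of_nat n - s) * ?P $ n"
    by (simp only: fps_hypergeo_1_0_nth) (simp add: pochhammer_Suc divide_simps del: of_nat_Suc)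
  have "((1 - fps_X) * fps_deriv ?P) $ n = of_nat (Suc n) * ?P $ Suc n - of_nat n * ?P $ n"
    unfolding eq by (cases n) (simp_all del: fps_hypergeo_nth of_nat_Suc)
  also have "\<dots> = - s * ?P $ n" by (simp only: 1) (simp add: algebra_simps del: fps_hypergeo_nth)
  finally show "((1 - fps_X) * fps_deriv ?P) $ n = (- fps_const s * ?P) $ n"
    by (simp del: fps_hypergeo_nth)
qed

text \<open>
  Conjugation by \<open>(1 - X)\<^bsup>c - a - b\<^esup>\<close> turns the hypergeometric operator with parameters
  \<open>a, b, c\<close> into the one with parameters \<open>c - a, c - b, c\<close>.
\<close>
lemma fps_hypergeo_op_mult:
  fixes a b c :: "'a :: field_char_0"
  defines "P \<equiv> fps_hypergeo [-(c - a - b)] [] 1"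
  shows "fps_hypergeo_op a b c (P * H) = P * fps_hypergeo_op (c - a) (c - b) c H"
proof -
  define A B C where "A = fps_const a" and "B = fps_const b" and "C = fps_const c"
  have P1: "(1 - fps_X) * fps_deriv P = - (C - A - B) * P"
    unfolding P_def fps_deriv_hypergeo_1_0 by (simp add: A_def B_def C_def)
  have deriv_0: "fps_deriv A = 0" "fps_deriv B = 0" "fps_deriv C = 0"
    by (simp_all add: A_def B_def C_def)
  have P2: "(1 - fps_X) * fps_deriv (fps_deriv P) = (1 - (C - A - B)) * fps_deriv P"
    using arg_cong[OF P1, of fps_deriv]
    by (simp add: deriv_0 algebra_simps)
  have C1: "fps_const (a + b + 1) = A + B + 1" "fps_const (a * b) = A * B"
     "fps_const (c - a + (c - b) + 1) = C - A + (C - B) + 1" "fps_const ((c - a) * (c - b)) = (C - A) * (C - B)"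
    by (simp_all add: A_def B_def C_def flip: fps_const_1_eq_1)
  define P' P'' H' H'' where "P' = fps_deriv P" and "P'' = fps_deriv P'" and "H' = fps_deriv H" and "H'' = fps_deriv H'"
  have D: "fps_deriv (fps_deriv (P * H)) = P'' * H + 2 * P' * H' + P * H''"
    by (simp add: P'_def P''_def H'_def H''_def algebra_simps)
  \<comment> \<open>\<open>E1\<close> and \<open>E2\<close> are the residuals of the first-order equation of \<open>P\<close> and of its derivative; the
      two sides of the claim differ by a combination of them.\<close>
  define E1 E2 where "E1 = (1 - fps_X) * P' + (C - A - B) * P"
    and "E2 = (1 - fps_X) * P'' - (1 - (C - A - B)) * P'"
  have "E1 = 0" "E2 = 0"
    using P1 P2 by (simp_all add: E1_def E2_def P'_def P''_def algebra_simps)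
  moreover have "fps_X * (1 - fps_X) * (P'' * H + 2 * P' * H' + P * H'') +
     (C - (A + B + 1) * fps_X) * (P' * H + P * H') - A * B * (P * H) -
     P * (fps_X * (1 - fps_X) * H'' + (C - (C - A + (C - B) + 1) * fps_X) * H' - (C - A) * (C - B) * H) =
     fps_X * H * E2 + (2 * fps_X * H' + C * H) * E1"
    by (simp add: E1_def E2_def algebra_simps)
  ultimately have "fps_X * (1 - fps_X) * (P'' * H + 2 * P' * H' + P * H'') +
     (C - (A + B + 1) * fps_X) * (P' * H + P * H') - A * B * (P * H) =
     P * (fps_X * (1 - fps_X) * H'' + (C - (C - A + (C - B) + 1) * fps_X) * H' - (C - A) * (C - B) * H)"
    by simp
  thus ?thesis
    unfolding fps_hypergeo_op_def D C1 C_def[symmetric]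
    by (simp add: P'_def P''_def H'_def H''_def algebra_simps)
qed

theorem fps_hypergeo_Euler:
  fixes a b c :: "'a :: field_char_0"
  assumes "c \<notin> \<int>\<^sub>\<le>\<^sub>0"
  shows "fps_hypergeo [a, b] [c] 1 =
           fps_hypergeo [-(c - a - b)] [] 1 * fps_hypergeo [c - a, c - b] [c] 1"
proof (rule fps_hypergeo_op_unique[OF assms])
  show "fps_hypergeo_op a b c (fps_hypergeo [a, b] [c] 1) = 0"
    by (rule fps_hypergeo_op_eq_0[OF assms])
  show "fps_hypergeo_op a b c (fps_hypergeo [-(c - a - b)] [] 1 * fps_hypergeo [c - a, c - b] [c] 1) = 0"
    unfolding fps_hypergeo_op_mult fps_hypergeo_op_eq_0[OF assms] by (rule mult_zero_right)
  show "fps_hypergeo [a, b] [c] 1 $ 0 =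
          (fps_hypergeo [-(c - a - b)] [] 1 * fps_hypergeo [c - a, c - b] [c] 1) $ 0"
    by (simp add: fps_mult_nth)
qed

section \<open>Saalschuetz's summation\<close>

text \<open>
  The terminating balanced \<open>\<^sub>3F\<^sub>2\<close> at \<open>1\<close>. Euler's transformation, read as
  \<open>F(c - a, c - b; c; X) = (1 - X)\<^bsup>a + b - c\<^esup> F(a, b; c; X)\<close>, has this sum as its coefficient of
  \<open>X\<^sup>n\<close>, up to a constant factor.
\<close>
theorem Saalschuetz:
  fixes a b c d :: "'a :: field_char_0"
  assumes c: "c \<notin> \<int>\<^sub>\<le>\<^sub>0" and d: "d \<notin> \<int>\<^sub>\<le>\<^sub>0"
    and balanced: "c + d = a + b - of_nat n + 1"
  shows "(\<Sum>k\<le>n. pochhammer (- of_nat n) k * pochhammer a k * pochhammer b k /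
            (pochhammer c k * pochhammer d k * fact k)) =
         (-1) ^ n * pochhammer (c - a) n * pochhammer (c - b) n / (pochhammer c n * pochhammer d n)"
  (is "?S = _")
proof -
  have nz: "pochhammer c k \<noteq> 0" "pochhammer d k \<noteq> 0" for k
    using c d by (auto simp: pochhammer_eq_0_iff)
  have "pochhammer (c - a) n * pochhammer (c - b) n / (pochhammer c n * fact n) =
        (fps_hypergeo [a, b] [c] 1 * fps_hypergeo [c - a - b] [] 1) $ n"
    using fps_hypergeo_Euler[OF c, of "c - a" "c - b"]
    by (subst fps_hypergeo_2_1_nth [symmetric]) (simp add: algebra_simps del: fps_hypergeo_nth)
  also have "\<dots> = (\<Sum>k\<le>n. pochhammer a k * pochhammer b k / (pochhammer c k * fact k) *
                        (pochhammer (c - a - b) (n - k) / fact (n - k)))"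
    by (simp only: fps_mult_nth fps_hypergeo_2_1_nth fps_hypergeo_1_0_nth atLeast0AtMost)
  also have "\<dots> = (\<Sum>k\<le>n. (-1) ^ n * pochhammer d n / fact n *
      (pochhammer (- of_nat n) k * pochhammer a k * pochhammer b k /
            (pochhammer c k * pochhammer d k * fact k)))"
  proof (rule sum.cong)
    fix k assume "k \<in> {..n}"
    hence k: "k \<le> n" by simp
    \<comment> \<open>The two factors indexed by \<open>n - k\<close> are reversed into factors indexed by \<open>k\<close>;
        this is where the balancing condition enters.\<close>
    have "c - a - b = - (d + of_nat n - 1)" using balanced by (simp add: algebra_simps)
    hence "pochhammer (c - a - b) (n - k) = (-1) ^ (n - k) * pochhammer (d + of_nat k) (n - k)"
      using k by (simp only: pochhammer_minus) (simp add: of_nat_diff algebra_simps)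
    also have "pochhammer (d + of_nat k) (n - k) = pochhammer d n / pochhammer d k"
      using pochhammer_product[OF k, of d] nz by (simp add: field_simps)
    finally have 1: "pochhammer (c - a - b) (n - k) = (-1) ^ (n - k) * pochhammer d n / pochhammer d k" by simp
    have "pochhammer (of_nat n - of_nat k + 1) k * fact (n - k) = (fact n :: 'a)"
      using pochhammer_product'[of "1 :: 'a" "n - k" k] k
      by (simp add: pochhammer_fact of_nat_diff[OF k] add_ac mult_ac add_diff_eq)
    hence 2: "1 / fact (n - k) = (-1) ^ k * pochhammer (- of_nat n) k / (fact n :: 'a)"
      by (simp add: pochhammer_minus field_simps)
    have 3: "(-1) ^ (n - k) * (-1) ^ k = ((-1) ^ n :: 'a)"
      using k by (simp flip: power_add)
    have "pochhammer a k * pochhammer b k / (pochhammer c k * fact k) *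
            (pochhammer (c - a - b) (n - k) / fact (n - k)) =
          pochhammer a k * pochhammer b k / (pochhammer c k * fact k) *
            ((-1) ^ (n - k) * pochhammer d n / pochhammer d k * (1 / fact (n - k)))"
      unfolding 1 by simp
    also have "\<dots> = (-1) ^ (n - k) * (-1) ^ k * pochhammer d n / fact n *
      (pochhammer (- of_nat n) k * pochhammer a k * pochhammer b k /
            (pochhammer c k * pochhammer d k * fact k))"
      unfolding 2 by (simp only: times_divide_eq_left times_divide_eq_right divide_divide_eq_left mult_ac)
    finally show "pochhammer a k * pochhammer b k / (pochhammer c k * fact k) *
            (pochhammer (c - a - b) (n - k) / fact (n - k)) =
          (-1) ^ n * pochhammer d n / fact n *
      (pochhammer (- of_nat n) k * pochhammer a k * pochhammer b k /
            (pochhammer c k * pochhammer d k * fact k))"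
      unfolding 3 .
  qed simp
  finally have eq: "pochhammer (c - a) n * pochhammer (c - b) n / (pochhammer c n * fact n) =
      (-1) ^ n * pochhammer d n / fact n * ?S"
    unfolding sum_distrib_left [symmetric] .
  have "(-1) ^ n * (-1) ^ n = (1 :: 'a)" by (simp flip: power_mult_distrib)
  hence "?S = ((-1) ^ n * (-1) ^ n) * ?S" by simp
  also have "\<dots> = (-1) ^ n * fact n / pochhammer d n * ((-1) ^ n * pochhammer d n / fact n * ?S)"
    using nz by simp
  also have "\<dots> = (-1) ^ n * pochhammer (c - a) n * pochhammer (c - b) n / (pochhammer c n * pochhammer d n)"
    unfolding eq [symmetric] using nz by (simp add: mult_ac)
  finally show ?thesis .
qed

section \<open>The integrand as a combination of Beta integrands\<close>

text \<open>
  Euler's transformation as an identity of functions in the unit disc, for the case in which the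
  transformed series is a polynomial: its parameter \<open>c - b\<close> is \<open>- n\<close>.
\<close>
lemma hypergeom_2F1_Euler_terminating:
  fixes a c z :: complex
  assumes c: "c \<notin> \<int>\<^sub>\<le>\<^sub>0" and z: "norm z < 1"
  shows "hypergeom_2F1 a (c + of_nat n) c z =
           (1 - z) powr (- a - of_nat n) *
           (\<Sum>k\<le>n. pochhammer (c - a) k * pochhammer (- of_nat n) k / (pochhammer c k * fact k) * z ^ k)"
proof -
  define s where "s = - a - of_nat n"
  define p where "p k = pochhammer (- s) k / fact k * z ^ k" for k
  define h where "h k = pochhammer (c - a) k * pochhammer (- of_nat n) k / (pochhammer c k * fact k) * z ^ k" for k
  have binomial: "(\<lambda>k. pochhammer (- s) k / fact k * w ^ k) sums (1 - w) powr s" if "norm w < 1" for w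
  proof -
    have "(s gchoose k) * (- w) ^ k = pochhammer (- s) k / fact k * w ^ k" for k
      by (simp add: gbinomial_pochhammer power_minus[of w])
    thus ?thesis using gen_binomial_complex[of "- w" s] that by simp
  qed
  have "summable (\<lambda>k. norm (p k))"
    unfolding p_def
  proof (rule powser_insidea)
    let ?x = "complex_of_real ((1 + norm z) / 2)"
    have x: "norm ?x = (1 + norm z) / 2" by (subst norm_of_real) simp
    show "norm z < norm ?x" using z x by simp
    show "summable (\<lambda>k. pochhammer (- s) k / fact k * ?x ^ k)"
      using z x by (intro sums_summable[OF binomial]) simp
  qed
  moreover have h_0: "h k = 0" if "k \<notin> {..n}" for k
    using that by (auto simp: h_def pochhammer_of_nat_eq_0_iff)
  hence "summable (\<lambda>k. norm (h k))"
    by (intro summable_finite[of "{..n}"]) auto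
  ultimately have "(\<lambda>k. \<Sum>i\<le>k. p i * h (k - i)) sums (suminf p * suminf h)"
    by (rule Cauchy_product_sums)
  moreover have "(\<Sum>i\<le>k. p i * h (k - i)) =
      pochhammer a k * pochhammer (c + of_nat n) k / pochhammer c k * (z ^ k / fact k)" for k
  proof -
    have "(\<Sum>i\<le>k. p i * h (k - i)) =
        (fps_hypergeo [- s] [] 1 * fps_hypergeo [c - a, - of_nat n] [c] 1) $ k * z ^ k"
      unfolding fps_mult_nth fps_hypergeo_1_0_nth fps_hypergeo_2_1_nth atLeast0AtMost
        sum_distrib_right
      by (intro sum.cong) (simp_all add: p_def h_def flip: power_add)
    also have "fps_hypergeo [- s] [] 1 * fps_hypergeo [c - a, - of_nat n] [c] 1 =
        fps_hypergeo [a, c + of_nat n] [c] 1"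
      using fps_hypergeo_Euler[OF c, of a "c + of_nat n"] by (simp add: s_def)
    finally show ?thesis by simp
  qed
  ultimately have "hypergeom_2F1 a (c + of_nat n) c z = suminf p * suminf h"
    by (simp add: hypergeom_2F1_def sums_iff)
  also have "suminf p = (1 - z) powr s"
    using binomial[OF z] by (simp add: p_def [abs_def] sums_iff)
  also have "suminf h = (\<Sum>k\<le>n. h k)"
    using h_0 by (intro suminf_finite) auto
  finally show ?thesis by (simp add: s_def h_def)
qed

text \<open>
  The integrand at \<open>x = 1 - 2 t\<close>. The factor \<open>(1 - t)\<^sup>\<lambda>\<close> from Euler's transformation combines with
  the algebraic weights to \<open>t\<^bsup>\<lambda> - \<gamma>\<^esup> (1 - t)\<^sup>\<lambda>\<close>. The exponents are written as \<open>\<dots> - 1\<close> to exhibit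
  the parameters of the Beta integrals.
\<close>
lemma ferrers_integrand_eq:
  fixes lam \<gamma> :: complex and t :: real
  assumes lam: "Re lam > -1" and t: "t \<in> {0<..<1}"
  shows "complex_of_real (2 * t) powr (lam / 2 - \<gamma>) * complex_of_real (2 * (1 - t)) powr (lam / 2) *
           ferrers_P_neg (of_nat n + lam) lam (1 - 2 * t) =
         2 powr (lam - \<gamma>) / Gamma (lam + 1) *
         (\<Sum>k\<le>n. pochhammer (- of_nat n) k * pochhammer (2 * lam + of_nat n + 1) k /
                   (pochhammer (lam + 1) k * fact k) *
                   (real_cpow t (lam - \<gamma> + of_nat k + 1 - 1) * real_cpow (1 - t) (lam + 1 - 1)))"
proof -
  define S where "S = (\<Sum>k\<le>n. pochhammer (- of_nat n) k * pochhammer (2 * lam + of_nat n + 1) k /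
                   (pochhammer (lam + 1) k * fact k) * complex_of_real t ^ k)"
  have "hypergeom_2F1 (- (of_nat n + lam)) (lam + 1 + of_nat n) (lam + 1) (complex_of_real t) =
          (1 - complex_of_real t) powr lam * S"
    using t lam
    by (subst hypergeom_2F1_Euler_terminating)
       (simp_all add: S_def Re_pos_imp_not_nonpos_Int algebra_simps)
  moreover have arg_eq: "(1 - (1 - 2 * t)) / (1 + (1 - 2 * t)) = t / (1 - t)" "(1 - (1 - 2 * t)) / 2 = t"
    using t by (simp_all add: field_simps)
  ultimately have ferrers_eq: "ferrers_P_neg (of_nat n + lam) lam (1 - 2 * t) =
      1 / Gamma (lam + 1) * (complex_of_real (t / (1 - t)) powr (lam / 2) * complex_of_real (1 - t) powr lam) * S"
    using arg_eq by (simp only: ferrers_P_neg_def) (simp add: add_ac)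
  have weights: "complex_of_real (2 * t) powr (lam / 2 - \<gamma>) * complex_of_real (2 * (1 - t)) powr (lam / 2) *
      (complex_of_real (t / (1 - t)) powr (lam / 2) * complex_of_real (1 - t) powr lam) =
      2 powr (lam - \<gamma>) * real_cpow t (lam - \<gamma>) * real_cpow (1 - t) lam"
  proof -
    have powr_exp: "complex_of_real r powr s = exp (s * complex_of_real (ln r))" if "r > 0" for r s
      using that by (simp add: powr_def Ln_of_real)
    have pos: "2 * t > 0" "2 * (1 - t) > 0" "t / (1 - t) > 0" "1 - t > 0"
      using t by simp_all
    have powr_2: "2 powr (lam - \<gamma>) = exp ((lam - \<gamma>) * complex_of_real (ln 2))"
      using powr_exp[of 2] by simp
    have ln_eq: "ln (2 * t) = ln 2 + ln t" "ln (2 * (1 - t)) = ln 2 + ln (1 - t)"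
      "ln (t / (1 - t)) = ln t - ln (1 - t)"
      using t ln_mult[of 2 t] ln_mult[of 2 "1 - t"] ln_div[of t "1 - t"] by simp_all
    have cpow_eq: "real_cpow t (lam - \<gamma>) = exp ((lam - \<gamma>) * complex_of_real (ln t))"
      "real_cpow (1 - t) lam = exp (lam * complex_of_real (ln (1 - t)))"
      using t by (simp_all add: real_cpow_altdef)
    have exponents: "(lam / 2 - \<gamma>) * complex_of_real (ln 2 + ln t) + lam / 2 * of_real (ln 2 + ln (1 - t)) +
            (lam / 2 * of_real (ln t - ln (1 - t)) + lam * of_real (ln (1 - t))) =
          (lam - \<gamma>) * complex_of_real (ln 2) + (lam - \<gamma>) * of_real (ln t) + lam * of_real (ln (1 - t))"
      by (simp add: field_simps)
    show ?thesis
      unfolding powr_2 powr_exp[OF pos(1)] powr_exp[OF pos(2)] powr_exp[OF pos(3)]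
        powr_exp[OF pos(4)] ln_eq cpow_eq exp_add [symmetric] exponents
      by (rule refl)
  qed
  have cpow_add: "real_cpow t (lam - \<gamma> + of_nat k + 1 - 1) = real_cpow t (lam - \<gamma>) * complex_of_real t ^ k" for k
    using t by (simp add: real_cpow_def powr_add powr_nat')
  have "complex_of_real (2 * t) powr (lam / 2 - \<gamma>) * complex_of_real (2 * (1 - t)) powr (lam / 2) *
          ferrers_P_neg (of_nat n + lam) lam (1 - 2 * t) =
        1 / Gamma (lam + 1) *
          (complex_of_real (2 * t) powr (lam / 2 - \<gamma>) * complex_of_real (2 * (1 - t)) powr (lam / 2) *
           (complex_of_real (t / (1 - t)) powr (lam / 2) * complex_of_real (1 - t) powr lam)) * S"
    unfolding ferrers_eq by (simp only: mult_ac)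
  also have "\<dots> = 2 powr (lam - \<gamma>) / Gamma (lam + 1) * (real_cpow t (lam - \<gamma>) * real_cpow (1 - t) lam * S)"
    unfolding weights by simp
  also have "real_cpow t (lam - \<gamma>) * real_cpow (1 - t) lam * S =
      (\<Sum>k\<le>n. pochhammer (- of_nat n) k * pochhammer (2 * lam + of_nat n + 1) k /
                   (pochhammer (lam + 1) k * fact k) *
                   (real_cpow t (lam - \<gamma> + of_nat k + 1 - 1) * real_cpow (1 - t) (lam + 1 - 1)))"
    unfolding S_def sum_distrib_left cpow_add by (intro sum.cong) simp_all
  finally show ?thesis .
qed

section \<open>Evaluation of the integral\<close>

lemma Beta_add_of_nat_left:
  fixes z w :: complex
  assumes "z \<notin> \<int>\<^sub>\<le>\<^sub>0" and "z + w \<notin> \<int>\<^sub>\<le>\<^sub>0"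
  shows "Beta (z + of_nat k) w = pochhammer z k / pochhammer (z + w) k * Beta z w"
proof -
  have "Gamma z \<noteq> 0" "Gamma (z + w) \<noteq> 0" "pochhammer (z + w) k \<noteq> 0"
    using assms by (auto simp: Gamma_eq_zero_iff pochhammer_eq_0_iff)
  moreover have "Gamma (z + of_nat k) = pochhammer z k * Gamma z"
    "Gamma (z + of_nat k + w) = pochhammer (z + w) k * Gamma (z + w)"
    using assms calculation by (simp_all add: pochhammer_Gamma add_ac)
  ultimately show ?thesis by (simp add: Beta_def)
qed

text \<open>
  The evaluation with \<open>\<Gamma>(\<gamma> + n) / \<Gamma>(\<gamma>)\<close> replaced by the rising factorial of \<open>\<gamma>\<close>, in which form
  no value of \<open>\<gamma>\<close> is exceptional.
\<close>
lemma has_bochner_integral_ferrers: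
  fixes lam \<gamma> :: complex
  assumes lam: "Re lam > -1" and lam_\<gamma>: "Re (lam - \<gamma>) > -1"
  shows "has_bochner_integral lborel
           (\<lambda>x. indicator {-1<..<1} x *\<^sub>R
              (complex_of_real (1 - x) powr (lam / 2 - \<gamma>) * complex_of_real (1 + x) powr (lam / 2) *
               ferrers_P_neg (of_nat n + lam) lam x))
           (2 powr (lam - \<gamma> + 1) * Gamma (lam - \<gamma> + 1) * pochhammer \<gamma> n / Gamma (2 * lam - \<gamma> + of_nat n + 2))"
    (is "has_bochner_integral _ ?f ?I")
proof -
  \<comment> \<open>\<open>a\<close>, \<open>b\<close>, \<open>c\<close>, \<open>d\<close> are the parameters of the balanced sum that remains after the
      integration.\<close>
  define a b c d where "a = 2 * lam + of_nat n + 1" and "b = lam - \<gamma> + 1"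
    and "c = 2 * lam - \<gamma> + 2" and "d = lam + 1"
  have Re_pos: "Re b > 0" "Re c > 0" "Re d > 0"
    using lam lam_\<gamma> by (simp_all add: b_def c_def d_def)
  hence nonpole: "b \<notin> \<int>\<^sub>\<le>\<^sub>0" "c \<notin> \<int>\<^sub>\<le>\<^sub>0" "d \<notin> \<int>\<^sub>\<le>\<^sub>0"
    by (simp_all add: Re_pos_imp_not_nonpos_Int)
  hence nz: "Gamma c \<noteq> 0" "Gamma d \<noteq> 0" "pochhammer c k \<noteq> 0" "pochhammer d k \<noteq> 0" for k
    by (auto simp: Gamma_eq_zero_iff pochhammer_eq_0_iff)
  have c_eq: "c = b + d" by (simp add: b_def c_def d_def)
  define C where "C k = pochhammer (- of_nat n) k * pochhammer a k / (pochhammer d k * fact k)" for k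
  have "(\<Sum>k\<le>n. C k * Beta (b + of_nat k) d) =
        Beta b d * (\<Sum>k\<le>n. pochhammer (- of_nat n) k * pochhammer a k * pochhammer b k /
            (pochhammer c k * pochhammer d k * fact k))"
    unfolding sum_distrib_left
    by (intro sum.cong) (use nonpole in \<open>simp_all add: Beta_add_of_nat_left C_def c_eq mult_ac\<close>)
  also have "(\<Sum>k\<le>n. pochhammer (- of_nat n) k * pochhammer a k * pochhammer b k /
            (pochhammer c k * pochhammer d k * fact k)) =
         (-1) ^ n * pochhammer (c - a) n * pochhammer (c - b) n / (pochhammer c n * pochhammer d n)"
    by (rule Saalschuetz) (use nonpole in \<open>simp_all add: a_def b_def c_def d_def\<close>)
  also have "(-1) ^ n * pochhammer (c - a) n = pochhammer \<gamma> n"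
  proof -
    have "c - a = - (\<gamma> + of_nat n - 1)" by (simp add: a_def c_def)
    thus ?thesis by (simp only: pochhammer_minus) (simp flip: power_mult_distrib)
  qed
  also have "c - b = d" by (simp add: c_eq)
  finally have sum_eq: "(\<Sum>k\<le>n. C k * Beta (b + of_nat k) d) = Gamma b * Gamma d * pochhammer \<gamma> n / Gamma (c + of_nat n)"
    using nonpole(2) nz by (simp add: Beta_def c_eq pochhammer_Gamma)

  have "has_bochner_integral lborel
      (\<lambda>t. 2 powr (lam - \<gamma>) / Gamma d *
           (\<Sum>k\<le>n. C k * (real_cpow t (b + of_nat k - 1) * real_cpow (1 - t) (d - 1))))
      (2 powr (lam - \<gamma>) / Gamma d * (\<Sum>k\<le>n. C k * Beta (b + of_nat k) d))"
    using Re_pos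
    by (intro has_bochner_integral_mult_right has_bochner_integral_sum has_bochner_integral_Beta_complex) auto
  also have "(\<lambda>t. 2 powr (lam - \<gamma>) / Gamma d *
           (\<Sum>k\<le>n. C k * (real_cpow t (b + of_nat k - 1) * real_cpow (1 - t) (d - 1)))) =
      (\<lambda>t. ?f (1 + (-2) * t))"
  proof
    fix t :: real
    show "2 powr (lam - \<gamma>) / Gamma d *
           (\<Sum>k\<le>n. C k * (real_cpow t (b + of_nat k - 1) * real_cpow (1 - t) (d - 1))) = ?f (1 + (-2) * t)"
    proof (cases "t \<in> {0<..<1}")
      case True
      have 1: "1 - (1 + (-2) * t) = 2 * t" "1 + (1 + (-2) * t) = 2 * (1 - t)" "1 + (-2) * t = 1 - 2 * t" by simp_all
      have "?f (1 + (-2) * t) = complex_of_real (2 * t) powr (lam / 2 - \<gamma>) *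
         complex_of_real (2 * (1 - t)) powr (lam / 2) * ferrers_P_neg (of_nat n + lam) lam (1 - 2 * t)"
        unfolding 1 using True by simp
      also have "\<dots> = 2 powr (lam - \<gamma>) / Gamma d *
           (\<Sum>k\<le>n. C k * (real_cpow t (b + of_nat k - 1) * real_cpow (1 - t) (d - 1)))"
        unfolding ferrers_integrand_eq[OF lam True] by (simp add: C_def a_def b_def d_def add_ac)
      finally show ?thesis ..
    qed (auto simp: real_cpow_def)
  qed
  also have "2 powr (lam - \<gamma>) / Gamma d * (\<Sum>k\<le>n. C k * Beta (b + of_nat k) d) = ?I /\<^sub>R \<bar>-2\<bar>"
    unfolding sum_eq using nz
    by (simp add: b_def c_def add_ac powr_add scaleR_conv_of_real)
  finally show ?thesis
    by (subst lborel_has_bochner_integral_real_affine_iff[of "-2" _ _ 1]) simp_all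
qed

text \<open>
  When \<open>g\<close> is a pole of \<open>\<Gamma>\<close> but \<open>g + n\<close> is not, the quotient is \<open>0\<close> by the convention on division
  by zero, and the rising factorial has a vanishing factor, so the identity persists.
\<close>
lemma Gamma_ratio_eq_pochhammer:
  fixes g :: complex
  assumes "g + of_nat n \<notin> \<int>\<^sub>\<le>\<^sub>0"
  shows "Gamma (g + of_nat n) / Gamma g = pochhammer g n"
proof (cases "g \<in> \<int>\<^sub>\<le>\<^sub>0")
  case True
  then obtain m where m: "g = - of_nat m" by (elim nonpos_Ints_cases')
  have "m < n"
  proof (rule ccontr)
    assume "\<not> m < n"
    hence "g + of_nat n = - of_nat (m - n)" by (simp add: m of_nat_diff)
    with assms show False by simp
  qed
  with m True show ?thesis by (simp add: Gamma_eq_zero_iff pochhammer_of_nat_eq_0_iff)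
qed (simp add: pochhammer_Gamma)

lemma eventually_at_not_nonpos_Int:
  fixes z :: complex
  assumes "z \<in> \<int>"
  shows "eventually (\<lambda>w. w \<notin> \<int>\<^sub>\<le>\<^sub>0) (at z)"
  unfolding eventually_at
proof (intro exI[of _ 1] conjI ballI impI notI)
  fix w :: complex assume w: "w \<noteq> z \<and> dist w z < 1" "w \<in> \<int>\<^sub>\<le>\<^sub>0"
  hence "w - z \<in> \<int>" using assms nonpos_Ints_subset_Ints by (intro Ints_diff) auto
  then obtain k where "w - z = of_int k" by (elim Ints_cases)
  moreover from this w have "\<bar>real_of_int k\<bar> < 1" by (simp add: dist_norm)
  hence "k = 0" by linarith
  ultimately show False using w by simp
qed simp

theorem corollary3p6:
  fixes n :: nat and lam \<gamma> :: complex
  assumes "Re lam > -1" and "Re (lam - \<gamma>) > -1"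
  shows
    "let f = (\<lambda>x::real. complex_of_real (1 - x) powr (lam / 2 - \<gamma>) *
                complex_of_real (1 + x) powr (lam / 2) *
                ferrers_P_neg (of_nat n + lam) lam x);
         R = (\<lambda>g::complex. 2 powr (lam - g + 1) * Gamma (lam - g + 1) * Gamma (g + of_nat n) /
                (Gamma g * Gamma (2 * lam - g + of_nat n + 2)))
     in f absolutely_integrable_on {-1<..<1} \<and>
        (if \<gamma> + of_nat n \<notin> \<int>\<^sub>\<le>\<^sub>0
         then integral {-1<..<1} f = R \<gamma>
         else (R \<longlongrightarrow> integral {-1<..<1} f) (at \<gamma>))"
proof -
  define f where "f = (\<lambda>x::real. complex_of_real (1 - x) powr (lam / 2 - \<gamma>) *
                complex_of_real (1 + x) powr (lam / 2) * ferrers_P_neg (of_nat n + lam) lam x)"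
  define R where "R = (\<lambda>g::complex. 2 powr (lam - g + 1) * Gamma (lam - g + 1) * Gamma (g + of_nat n) /
                (Gamma g * Gamma (2 * lam - g + of_nat n + 2)))"
  define V where "V = (\<lambda>g::complex. 2 powr (lam - g + 1) * Gamma (lam - g + 1) * pochhammer g n /
                Gamma (2 * lam - g + of_nat n + 2))"
  have f: "has_bochner_integral lborel (\<lambda>x. indicator {-1<..<1} x *\<^sub>R f x) (V \<gamma>)"
    unfolding f_def V_def using assms by (rule has_bochner_integral_ferrers)
  hence f_int: "set_integrable lborel {-1<..<1} f"
    by (simp add: set_integrable_def has_bochner_integral_iff)
  have integral_eq: "integral {-1<..<1} f = V \<gamma>"
    using set_borel_integral_eq_integral(2)[OF f_int] f
    by (simp add: set_lebesgue_integral_def has_bochner_integral_iff)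
  have abs_int: "f absolutely_integrable_on {-1<..<1}"
    using f_int unfolding set_integrable_def
    by (subst integrable_completion) (auto dest: borel_measurable_integrable)
  have R_eq: "R g = V g" if "g + of_nat n \<notin> \<int>\<^sub>\<le>\<^sub>0" for g
    by (simp add: R_def V_def flip: Gamma_ratio_eq_pochhammer[OF that])
  have "(R \<longlongrightarrow> V \<gamma>) (at \<gamma>)" if "\<gamma> + of_nat n \<in> \<int>\<^sub>\<le>\<^sub>0"
  proof -
    have "\<gamma> + of_nat n - of_nat n \<in> \<int>"
      using that nonpos_Ints_subset_Ints by (intro Ints_diff) auto
    hence "eventually (\<lambda>g. g \<notin> \<int>\<^sub>\<le>\<^sub>0) (at \<gamma>)"
      by (intro eventually_at_not_nonpos_Int) simp
    hence "eventually (\<lambda>g. V g = R g) (at \<gamma>)"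
    proof eventually_elim
      case (elim g)
      thus ?case by (simp add: R_def V_def pochhammer_Gamma)
    qed
    \<comment> \<open>\<open>V\<close> has no singularity at \<open>\<gamma>\<close>, so the limit of \<open>R\<close> is the value of \<open>V\<close>.\<close>
    moreover have "2 * lam - \<gamma> + of_nat n + 2 \<notin> \<int>\<^sub>\<le>\<^sub>0" "lam - \<gamma> + 1 \<notin> \<int>\<^sub>\<le>\<^sub>0"
      using assms by (auto intro!: Re_pos_imp_not_nonpos_Int)
    hence "isCont V \<gamma>"
      unfolding V_def
      by (intro continuous_intros) (auto simp: Gamma_eq_zero_iff)
    hence "(V \<longlongrightarrow> V \<gamma>) (at \<gamma>)" by (simp add: isCont_def)
    ultimately show ?thesis by (simp add: tendsto_cong)
  qed
  thus ?thesis
    unfolding Let_def f_def[symmetric] R_def[symmetric] using abs_int R_eq by (simp add: integral_eq)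
qed

end
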